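(* Let $d\in(0,\tfrac12)$, $\mu\in(0,1]$ and $\rho\ge\tfrac12\mu(1+\mu)$. Let $\mathcal{D}$ be a joint distribution of $(\mathbf{x},y)$ on $\mathcal{X}\times\{+1,-1\}$. For any measurable function $f:\mathcal{X}\to\mathbb{R}$, $$\mathcal{R}_d(f,\rho)-\mathcal{R}_d(f_d^*,\rho_d^* )\le\mathcal{R}_{dr}(f,\rho)-\mathcal{R}_{dr}(f_d^*,\rho_d^* ).$$
   Context: Write $[a]_+=\max(0,a)$, $\mathbf{1}_{\{\cdot\}}$ for the indicator, and $\eta(\mathbf{x})=P(y=1\mid\mathbf{x})$. The reject-option loss and the double ramp loss are $$L_d(yf(\mathbf{x}),\rho)=\mathbf{1}_{\{yf(\mathbf{x})<-\rho\}}+d\,\mathbf{1}_{\{|f(\mathbf{x})|\le\rho\}},$$ $$L_{dr}(t,\rho)=\frac{d}{\mu}\Big[[\mu-t+\rho]_+-[-\mu^2-t+\rho]_+\Big]+\frac{1-d}{\mu}\Big[[\mu-t-\rho]_+-[-\mu^2-t-\rho]_+\Big].$$ The risks are $\mathcal{R}_d(f,\rho)=\mathbb{E}[L_d(yf(\mathbf{x}),\rho)]$ and $\mathcal{R}_{dr}(f,\rho)=\mathbb{E}[L_{dr}(yf(\mathbf{x}),\rho)]$, with expectation over $\mathcal{D}$. The pair $(f_d^*,\rho_d^* )$ denotes the generalized Bayes (optimal) reject option classifier, and its risks are the optimal risks: $$\mathcal{R}_d(f_d^*,\rho_d^* )=\mathbb{E}[\xi(\eta(\mathbf{x}))],\qquad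 \mathcal{R}_{dr}(f_d^*,\rho_d^* )=\mathbb{E}[H(\eta(\mathbf{x}))],$$ where $$\xi(\eta)=\eta\,\mathbf{1}_{\{\eta<d\}}+d\,\mathbf{1}_{\{d\le\eta\le1-d\}}+(1-\eta)\mathbf{1}_{\{\eta>1-d\}},$$ $$H(\eta)=\inf_{z\in\mathbb{R},\ \rho'\ge\frac12\mu(1+\mu)}\ \eta L_{dr}(z,\rho')+(1-\eta)L_{dr}(-z,\rho').$$ *)

theory Defs
  imports "HOL-Probability.Probability"
begin

definition pos_part :: "real \<Rightarrow> real"
  where "pos_part a = max 0 a"

definition reject_loss :: "real \<Rightarrow> real \<Rightarrow> real \<Rightarrow> real \<Rightarrow> real"
  where "reject_loss d y v \<rho> = of_bool (y * v < - \<rho>) + d * of_bool (\<bar>v\<bar> \<le> \<rho>)"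

definition double_ramp_loss :: "real \<Rightarrow> real \<Rightarrow> real \<Rightarrow> real \<Rightarrow> real"
  where "double_ramp_loss d \<mu> t \<rho> =
    d / \<mu> * (pos_part (\<mu> - t + \<rho>) - pos_part (- \<mu>\<^sup>2 - t + \<rho>)) +
    (1 - d) / \<mu> * (pos_part (\<mu> - t - \<rho>) - pos_part (- \<mu>\<^sup>2 - t - \<rho>))"

definition joint_distribution :: "'a measure \<Rightarrow> ('a \<times> real) measure \<Rightarrow> bool"
  where "joint_distribution X D \<longleftrightarrow>
    prob_space D \<and> sets D = sets (X \<Otimes>\<^sub>M count_space {-1, 1})"

definition risk_d ::
  "('a \<times> real) measure \<Rightarrow> real \<Rightarrow> ('a \<Rightarrow> real) \<Rightarrow> real \<Rightarrow> real"
  where "risk_d D d f \<rho> = (\<integral>(x, y). reject_loss d y (f x) \<rho> \<partial>D)"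

definition risk_dr ::
  "('a \<times> real) measure \<Rightarrow> real \<Rightarrow> real \<Rightarrow> ('a \<Rightarrow> real) \<Rightarrow> real \<Rightarrow> real"
  where "risk_dr D d \<mu> f \<rho> = (\<integral>(x, y). double_ramp_loss d \<mu> (y * f x) \<rho> \<partial>D)"

text \<open>The sub-\<open>\<sigma>\<close>-algebra generated by the feature \<open>x\<close> and the conditional probability
  \<open>P(y = 1 | x)\<close> as a random variable on the product space. A version of \<open>\<eta>\<close> is a measurable
  function of \<open>x\<close> alone that represents it almost everywhere.\<close>

definition feature_algebra :: "'a measure \<Rightarrow> ('a \<times> real) measure \<Rightarrow> ('a \<times> real) measure"
  where "feature_algebra X D = vimage_algebra (space D) fst X"

definition label_prob :: "'a measure \<Rightarrow> ('a \<times> real) measure \<Rightarrow> 'a \<times> real \<Rightarrow> real"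
  where "label_prob X D =
    real_cond_exp D (feature_algebra X D) (\<lambda>p. of_bool (snd p = 1))"

definition conditional_label_prob ::
  "'a measure \<Rightarrow> ('a \<times> real) measure \<Rightarrow> ('a \<Rightarrow> real) \<Rightarrow> bool"
  where "conditional_label_prob X D \<eta> \<longleftrightarrow>
    \<eta> \<in> borel_measurable X \<and> (AE p in D. \<eta> (fst p) = label_prob X D p)"

definition \<xi> :: "real \<Rightarrow> real \<Rightarrow> real"
  where "\<xi> d t = t * of_bool (t < d) + d * of_bool (d \<le> t \<and> t \<le> 1 - d)
    + (1 - t) * of_bool (t > 1 - d)"

text \<open>The set in the infimum is nonempty and bounded below for every real \<open>t\<close>, because the
  double ramp loss is bounded.\<close>

definition H :: "real \<Rightarrow> real \<Rightarrow> real \<Rightarrow> real"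
  where "H d \<mu> t = (INF (z, \<rho>) \<in> UNIV \<times> {1 / 2 * \<mu> * (1 + \<mu>)..}.
    t * double_ramp_loss d \<mu> z \<rho> + (1 - t) * double_ramp_loss d \<mu> (- z) \<rho>)"

definition optimal_risk_d ::
  "('a \<times> real) measure \<Rightarrow> ('a \<Rightarrow> real) \<Rightarrow> real \<Rightarrow> real"
  where "optimal_risk_d D \<eta> d = (\<integral>(x, y). \<xi> d (\<eta> x) \<partial>D)"

definition optimal_risk_dr ::
  "('a \<times> real) measure \<Rightarrow> ('a \<Rightarrow> real) \<Rightarrow> real \<Rightarrow> real \<Rightarrow> real"
  where "optimal_risk_dr D \<eta> d \<mu> = (\<integral>(x, y). H d \<mu> (\<eta> x) \<partial>D)"

text \<open>The optimal classifier is specified by its two risks.\<close>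

definition generalized_bayes ::
  "'a measure \<Rightarrow> ('a \<times> real) measure \<Rightarrow> ('a \<Rightarrow> real) \<Rightarrow> real \<Rightarrow> real \<Rightarrow>
    ('a \<Rightarrow> real) \<Rightarrow> real \<Rightarrow> bool"
  where "generalized_bayes X D \<eta> d \<mu> f \<rho> \<longleftrightarrow>
    f \<in> borel_measurable X \<and>
    risk_d D d f \<rho> = optimal_risk_d D \<eta> d \<and>
    risk_dr D d \<mu> f \<rho> = optimal_risk_dr D \<eta> d \<mu>"

text \<open>A version of \<open>\<eta>\<close> always exists: a function measurable for the feature algebra does not
  depend on the label.\<close>

lemma conditional_label_prob_exists:
  assumes "joint_distribution X D"
  shows "\<exists>\<eta>. conditional_label_prob X D \<eta>"
proof -
  have sets_D: "sets D = sets (X \<Otimes>\<^sub>M count_space {-1, 1})"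
    using assms by (simp add: joint_distribution_def)
  have space_D: "space D = space X \<times> {-1, 1}"
    using sets_eq_imp_space_eq[OF sets_D] by (simp add: space_pair_measure)
  let ?F = "feature_algebra X D"
  let ?g = "label_prob X D"
  have gF: "?g \<in> borel_measurable ?F" and gD: "?g \<in> borel_measurable D"
    unfolding label_prob_def by simp_all
  have const: "?g (x, y) = ?g (x, 1)" if xy: "(x, y) \<in> space D" for x y
  proof -
    have "?g -` {?g (x, y)} \<inter> space D \<in> sets ?F"
      using measurable_sets[OF gF, of "{?g (x, y)}"] by (simp add: feature_algebra_def)
    moreover have "fst \<in> space D \<rightarrow> space X"
      by (auto simp: space_D)
    ultimately obtain A where A: "?g -` {?g (x, y)} \<inter> space D = fst -` A \<inter> space D"
      by (auto simp: feature_algebra_def sets_vimage_algebra2)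
    have "(x, y) \<in> fst -` A \<inter> space D"
      using xy by (subst A[symmetric]) simp
    then have "(x, 1) \<in> fst -` A \<inter> space D"
      by (auto simp: space_D)
    then show ?thesis
      by (subst (asm) A[symmetric]) simp
  qed
  have "(\<lambda>x. (x, 1)) \<in> measurable X D"
    by (subst measurable_cong_sets[OF refl sets_D]) (auto intro!: measurable_Pair)
  from measurable_compose[OF this gD]
  have "(\<lambda>x. ?g (x, 1)) \<in> borel_measurable X" .
  moreover have "AE p in D. ?g (fst p, 1) = ?g p"
    using const by (intro AE_I2) (metis prod.collapse)
  ultimately have "conditional_label_prob X D (\<lambda>x. ?g (x, 1))"
    by (simp add: conditional_label_prob_def)
  then show ?thesis by blast
qed

end

theory Submission
  imports Defs
begin

text \<open>Since \<open>\<rho> \<ge> \<mu> (1 + \<mu>) / 2 \<ge> \<mu>\<^sup>2\<close>, the ramp has its maximal value at \<open>-\<bar>z\<bar> - \<rho>\<close>, and a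
  piecewise linear estimate shows that the conditional double ramp risk exceeds the conditional
  reject-option risk by at least \<open>\<mu> \<xi>(\<eta>)\<close>. In particular it is at least \<open>(1 + \<mu>) \<xi>(\<eta>)\<close>, and this
  value is attained, so \<open>H = (1 + \<mu>) \<xi>\<close> on \<open>[0, 1]\<close>. Hence the difference of the two optimal
  risks is exactly \<open>\<mu> E[\<xi>(\<eta>)]\<close>, and integrating the pointwise estimate gives the theorem.\<close>

section \<open>The single ramp and its bounds\<close>

definition ramp :: "real \<Rightarrow> real \<Rightarrow> real"
  where "ramp \<mu> s = (pos_part (\<mu> - s) - pos_part (- \<mu>\<^sup>2 - s)) / \<mu>"

text \<open>Both steps of the loss, at \<open>\<rho>\<close> and at \<open>- \<rho>\<close>, are
  translates of one ramp. For \<open>0 < \<mu>\<close> it falls linearly from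
  \<open>1 + \<mu>\<close> at \<open>- \<mu>\<^sup>2\<close> through 1 at 0 down to 0 at
  \<open>\<mu>\<close>.\<close>

lemma double_ramp_loss_ramp:
  "double_ramp_loss d \<mu> t \<rho> = d * ramp \<mu> (t - \<rho>) + (1 - d) * ramp \<mu> (t + \<rho>)"
  by (simp add: double_ramp_loss_def ramp_def diff_diff_eq2 add.commute add_diff_eq diff_diff_eq)

lemma borel_measurable_double_ramp_loss [measurable]:
  "(\<lambda>t. double_ramp_loss d \<mu> t \<rho>) \<in> borel_measurable borel"
  unfolding double_ramp_loss_def pos_part_def by measurable

lemma borel_measurable_reject_loss [measurable]:
  "(\<lambda>v. reject_loss d y v \<rho>) \<in> borel_measurable borel"
  unfolding reject_loss_def of_bool_def by measurable

lemma borel_measurable_\<xi> [measurable]: "\<xi> d \<in> borel_measurable borel"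
  unfolding \<xi>_def [abs_def] of_bool_def by measurable

context
  fixes \<mu> :: real
  assumes \<mu>: "0 < \<mu>"
begin

lemma ramp_low:
  assumes "s \<le> - \<mu>\<^sup>2"
  shows "ramp \<mu> s = 1 + \<mu>"
proof -
  have "pos_part (\<mu> - s) = \<mu> - s" "pos_part (- \<mu>\<^sup>2 - s) = - \<mu>\<^sup>2 - s"
    using assms \<mu> zero_le_power2 [of \<mu>] unfolding pos_part_def by linarith+
  then show ?thesis
    using \<mu> by (simp add: ramp_def field_simps power2_eq_square)
qed

lemma ramp_mid: "- \<mu>\<^sup>2 \<le> s \<Longrightarrow> s \<le> \<mu> \<Longrightarrow> ramp \<mu> s = 1 - s / \<mu>"
  using \<mu> by (simp add: ramp_def pos_part_def max_def field_simps)

lemma ramp_high: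
  assumes "\<mu> \<le> s"
  shows "ramp \<mu> s = 0"
proof -
  have "pos_part (\<mu> - s) = 0" "pos_part (- \<mu>\<^sup>2 - s) = 0"
    using assms \<mu> zero_le_power2 [of \<mu>] unfolding pos_part_def by linarith+
  then show ?thesis
    by (simp add: ramp_def)
qed

lemma ramp_nonneg: "0 \<le> ramp \<mu> s"
proof -
  consider "s \<le> - \<mu>\<^sup>2" | "- \<mu>\<^sup>2 \<le> s" "s \<le> \<mu>" | "\<mu> \<le> s" by linarith
  then show ?thesis
    using \<mu> by cases (simp_all add: ramp_low ramp_mid ramp_high)
qed

lemma ramp_le: "ramp \<mu> s \<le> 1 + \<mu>"
proof -
  consider "s \<le> - \<mu>\<^sup>2" | "- \<mu>\<^sup>2 \<le> s" "s \<le> \<mu>" | "\<mu> \<le> s" by linarith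
  then show ?thesis
    using \<mu> by cases (simp_all add: ramp_low ramp_mid ramp_high field_simps power2_eq_square)
qed

lemma double_ramp_loss_bounds:
  assumes "0 < d" "d < 1"
  shows "0 \<le> double_ramp_loss d \<mu> t \<rho>" "double_ramp_loss d \<mu> t \<rho> \<le> 1 + \<mu>"
proof -
  show "0 \<le> double_ramp_loss d \<mu> t \<rho>"
    using assms by (simp add: double_ramp_loss_ramp ramp_nonneg)
  show "double_ramp_loss d \<mu> t \<rho> \<le> 1 + \<mu>"
    unfolding double_ramp_loss_ramp
    using assms by (intro convex_bound_le ramp_le) auto
qed

text \<open>One parameter \<open>w\<close> controls the ramp on both sides of its step, so that the
  later estimates become affine in \<open>w\<close>.\<close>

lemma ramp_symmetric_bound:
  assumes "0 \<le> s" "\<mu> \<le> 1"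
  shows "\<exists>w. 0 \<le> w \<and> w \<le> 1 \<and> ramp \<mu> (- s) = 1 + \<mu> * w \<and> 1 - w \<le> ramp \<mu> s"
proof (cases "s \<le> \<mu>\<^sup>2")
  case True
  have sq: "\<mu>\<^sup>2 \<le> \<mu>" using \<mu> assms by (simp add: power2_eq_square)
  have "ramp \<mu> (- s) = 1 + s / \<mu>"
    using ramp_mid [of "- s"] True assms \<mu> by simp
  moreover have "ramp \<mu> s = 1 - s / \<mu>"
    using ramp_mid [of s] True sq assms zero_le_power2 [of \<mu>] by linarith
  \<comment> \<open>The equation \<open>1 + s / \<mu> = 1 + \<mu> * w\<close> forces
    \<open>w = s / \<mu>\<^sup>2\<close>; the right-hand side falls more slowly than
    \<open>1 - w\<close> because \<open>\<mu> \<le> 1\<close>.\<close>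
  moreover have "s / \<mu> \<le> s / \<mu>\<^sup>2"
    using sq \<mu> assms by (intro divide_left_mono) auto
  ultimately show ?thesis
    using True assms \<mu> by (intro exI [of _ "s / \<mu>\<^sup>2"]) (simp add: power2_eq_square)
next
  case False
  \<comment> \<open>Beyond \<open>\<mu>\<^sup>2\<close> the left value is already maximal, so
    \<open>w = 1\<close> and the other bound is nonnegativity.\<close>
  then show ?thesis
    using ramp_low [of "- s"] ramp_nonneg [of s] by (intro exI [of _ 1]) simp
qed

end

section \<open>Conditional risks at a given label probability\<close>

definition cond_risk_d :: "real \<Rightarrow> real \<Rightarrow> real \<Rightarrow> real \<Rightarrow> real"
  where "cond_risk_d d t z \<rho> = t * reject_loss d 1 z \<rho> + (1 - t) * reject_loss d (- 1) z \<rho>"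

definition cond_risk_dr :: "real \<Rightarrow> real \<Rightarrow> real \<Rightarrow> real \<Rightarrow> real \<Rightarrow> real"
  where "cond_risk_dr d \<mu> t z \<rho> =
    t * double_ramp_loss d \<mu> z \<rho> + (1 - t) * double_ramp_loss d \<mu> (- z) \<rho>"

lemma H_cond_risk_dr:
  "H d \<mu> t = (INF (z, \<rho>) \<in> UNIV \<times> {1 / 2 * \<mu> * (1 + \<mu>)..}. cond_risk_dr d \<mu> t z \<rho>)"
  by (simp add: H_def cond_risk_dr_def)

lemma cond_risk_d_minus: "cond_risk_d d t (- z) \<rho> = cond_risk_d d (1 - t) z \<rho>"
  by (simp add: cond_risk_d_def reject_loss_def)

lemma cond_risk_dr_minus: "cond_risk_dr d \<mu> t (- z) \<rho> = cond_risk_dr d \<mu> (1 - t) z \<rho>"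
  by (simp add: cond_risk_dr_def)

text \<open>The values \<open>t\<close>, \<open>d\<close> and \<open>1 - t\<close> are the
  conditional costs of predicting -1, rejecting and predicting +1; since \<open>d < 1 / 2\<close>,
  the cases of \<open>\<xi>\<close> select the cheapest.\<close>

lemma \<xi>_eq_min: "0 < d \<Longrightarrow> d < 1 / 2 \<Longrightarrow> \<xi> d t = min t (min d (1 - t))"
  by (auto simp: \<xi>_def min_def)

text \<open>Each decision pays one of the three costs in the minimum, or 1 if a negative
  \<open>\<rho>\<close> makes both labels count as errors.\<close>

lemma \<xi>_le_cond_risk_d:
  assumes "0 < d" "d < 1 / 2" "0 \<le> t" "t \<le> 1"
  shows "\<xi> d t \<le> cond_risk_d d t z \<rho>"
proof -
  have "(1 - t) * d + t * d = d" by (simp add: algebra_simps)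
  moreover have "0 \<le> (1 - t) * d" "0 \<le> t * d" using assms by auto
  ultimately show ?thesis
    using assms
    by (auto simp: \<xi>_eq_min cond_risk_d_def reject_loss_def of_bool_def min_def algebra_simps
        split: if_splits)
qed

section \<open>Pointwise excess of the double ramp risk\<close>

context
  fixes d \<mu> :: real
  assumes d: "0 < d" "d < 1 / 2" and \<mu>: "0 < \<mu>" "\<mu> \<le> 1"
begin

text \<open>The right sides are what is left in the two cases of
  \<open>cond_risk_excess_nonneg\<close> once the reject-option risk is subtracted. They are affine
  in \<open>w\<close>, so they are compared with interpolations between \<open>\<mu> * d\<close> and
  \<open>\<mu> * (1 - t)\<close>.\<close>

lemma excess_margin:
  assumes t: "0 \<le> t" "t \<le> 1" and w: "0 \<le> w" "w \<le> 1"
  shows "\<mu> * \<xi> d t \<le> t * d * \<mu> * w + (1 - t) * d * \<mu> + (1 - t) * (1 - d) * (1 - w)"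
    and "\<mu> * \<xi> d t \<le> t * d * (1 - w) + (1 - t) * d * \<mu> + (1 - t) * (1 - d) * \<mu> * w"
proof -
  have xi: "\<mu> * \<xi> d t \<le> \<mu> * d" "\<mu> * \<xi> d t \<le> \<mu> * (1 - t)"
    using d \<mu> by (simp_all add: \<xi>_eq_min)
  have mix: "\<mu> * \<xi> d t \<le> w * (\<mu> * d) + (1 - w) * (\<mu> * (1 - t))"
            "\<mu> * \<xi> d t \<le> (1 - w) * (\<mu> * d) + w * (\<mu> * (1 - t))"
  proof -
    have "w * (\<mu> * \<xi> d t) + (1 - w) * (\<mu> * \<xi> d t) \<le> w * (\<mu> * d) + (1 - w) * (\<mu> * (1 - t))"
      by (intro add_mono mult_left_mono xi) (use w in auto)
    moreover have "(1 - w) * (\<mu> * \<xi> d t) + w * (\<mu> * \<xi> d t)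
        \<le> (1 - w) * (\<mu> * d) + w * (\<mu> * (1 - t))"
      by (intro add_mono mult_left_mono xi) (use w in auto)
    ultimately show "\<mu> * \<xi> d t \<le> w * (\<mu> * d) + (1 - w) * (\<mu> * (1 - t))"
      "\<mu> * \<xi> d t \<le> (1 - w) * (\<mu> * d) + w * (\<mu> * (1 - t))"
      by (simp_all add: algebra_simps)
  qed
  \<comment> \<open>This is the exact gap to the interpolation: it vanishes at \<open>w = 1\<close>,
    where the right side is \<open>\<mu> * d\<close>.\<close>
  have "0 \<le> (1 - w) * (1 - t) * (1 - d) * (1 - \<mu>)"
    using d \<mu> t w by simp
  then show "\<mu> * \<xi> d t \<le> t * d * \<mu> * w + (1 - t) * d * \<mu> + (1 - t) * (1 - d) * (1 - w)"
    using mix(1) by (simp add: algebra_simps)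
  \<comment> \<open>Again the exact gap, now with the value \<open>\<mu> * (1 - t)\<close> at
    \<open>w = 1\<close>.\<close>
  have "0 \<le> (1 - w) * t * d * (1 - \<mu>)"
    using d \<mu> t w by simp
  then show "\<mu> * \<xi> d t \<le> t * d * (1 - w) + (1 - t) * d * \<mu> + (1 - t) * (1 - d) * \<mu> * w"
    using mix(2) by (simp add: algebra_simps)
qed

lemma cond_risk_excess_nonneg:
  assumes t: "0 \<le> t" "t \<le> 1" and \<rho>: "1 / 2 * \<mu> * (1 + \<mu>) \<le> \<rho>" and z: "0 \<le> z"
  shows "cond_risk_d d t z \<rho> + \<mu> * \<xi> d t \<le> cond_risk_dr d \<mu> t z \<rho>"
proof -
  \<comment> \<open>The bound on \<open>\<rho>\<close> is the mean of \<open>\<mu>\<close> and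
    \<open>\<mu>\<^sup>2\<close>, hence at least \<open>\<mu>\<^sup>2\<close>.\<close>
  have "\<mu>\<^sup>2 \<le> \<mu>" using \<mu> by (simp add: power2_eq_square)
  then have sq: "\<mu>\<^sup>2 \<le> \<rho>" using \<rho> by (simp add: power2_eq_square algebra_simps)
  then have \<rho>0: "0 \<le> \<rho>" using zero_le_power2 [of \<mu>] by linarith
  \<comment> \<open>The two outer ramps are settled first: the one at \<open>- z - \<rho>\<close> is
    saturated, the one at \<open>z + \<rho>\<close> is only bounded below by 0. The ramps at
    \<open>z - \<rho>\<close> and its negative remain.\<close>
  have low: "ramp \<mu> (- z - \<rho>) = 1 + \<mu>"
    using sq z \<mu> by (intro ramp_low) auto
  have pos: "0 \<le> (1 - d) * ramp \<mu> (z + \<rho>)"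
    using d \<mu> by (simp add: ramp_nonneg)
  show ?thesis
  \<comment> \<open>The cases are rejection, including the boundary \<open>z = \<rho>\<close>, and a
    positive prediction.\<close>
  proof (cases "z \<le> \<rho>")
    case True
    then obtain w where w: "0 \<le> w" "w \<le> 1" "ramp \<mu> (z - \<rho>) = 1 + \<mu> * w"
      "1 - w \<le> ramp \<mu> (- z + \<rho>)"
      using ramp_symmetric_bound [of \<mu> "\<rho> - z"] \<mu> by auto
    have "d * (1 + \<mu> * w) \<le> double_ramp_loss d \<mu> z \<rho>"
      using pos by (simp add: double_ramp_loss_ramp w)
    moreover have "d * (1 + \<mu>) + (1 - d) * (1 - w) \<le> double_ramp_loss d \<mu> (- z) \<rho>"
      using d w by (simp add: double_ramp_loss_ramp low mult_left_mono)
    ultimately have "t * (d * (1 + \<mu> * w)) + (1 - t) * (d * (1 + \<mu>) + (1 - d) * (1 - w))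
        \<le> cond_risk_dr d \<mu> t z \<rho>"
      unfolding cond_risk_dr_def by (intro add_mono mult_left_mono) (use t in auto)
    moreover have "cond_risk_d d t z \<rho> = d"
      using True z by (simp add: cond_risk_d_def reject_loss_def algebra_simps)
    ultimately show ?thesis
      using excess_margin(1) [OF t w(1,2)] by (simp add: algebra_simps)
  next
    case False
    then obtain w where w: "0 \<le> w" "w \<le> 1" "ramp \<mu> (- z + \<rho>) = 1 + \<mu> * w"
      "1 - w \<le> ramp \<mu> (z - \<rho>)"
      using ramp_symmetric_bound [of \<mu> "z - \<rho>"] \<mu> by auto
    have "d * (1 - w) \<le> d * ramp \<mu> (z - \<rho>)"
      using w d by simp
    then have "d * (1 - w) \<le> double_ramp_loss d \<mu> z \<rho>"
      using pos by (simp add: double_ramp_loss_ramp)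
    moreover have "double_ramp_loss d \<mu> (- z) \<rho> = d * (1 + \<mu>) + (1 - d) * (1 + \<mu> * w)"
      using w(3) by (simp add: double_ramp_loss_ramp low del: uminus_add_conv_diff)
    ultimately have "t * (d * (1 - w)) + (1 - t) * (d * (1 + \<mu>) + (1 - d) * (1 + \<mu> * w))
        \<le> cond_risk_dr d \<mu> t z \<rho>"
      unfolding cond_risk_dr_def by (intro add_mono mult_left_mono) (use t in auto)
    moreover have "cond_risk_d d t z \<rho> = 1 - t"
      using False \<rho>0 by (simp add: cond_risk_d_def reject_loss_def)
    ultimately show ?thesis
      using excess_margin(2) [OF t w(1,2)] by (simp add: algebra_simps)
  qed
qed

text \<open>Reflecting \<open>z\<close> exchanges the labels, hence \<open>t\<close> and
  \<open>1 - t\<close>, and \<open>\<xi>\<close> is invariant under that exchange.\<close>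

lemma cond_risk_excess:
  assumes t: "0 \<le> t" "t \<le> 1" and \<rho>: "1 / 2 * \<mu> * (1 + \<mu>) \<le> \<rho>"
  shows "cond_risk_d d t z \<rho> + \<mu> * \<xi> d t \<le> cond_risk_dr d \<mu> t z \<rho>"
proof (cases "0 \<le> z")
  case True
  then show ?thesis using cond_risk_excess_nonneg assms by blast
next
  case False
  have "\<xi> d (1 - t) = \<xi> d t"
    using d by (simp add: \<xi>_eq_min min.commute min.left_commute)
  then show ?thesis
    using cond_risk_excess_nonneg [of "1 - t" \<rho> "- z"] False assms
    by (simp add: cond_risk_d_minus cond_risk_dr_minus)
qed

section \<open>The infimum of the conditional double ramp risk\<close>

lemma bdd_below_cond_risk_dr: "bdd_below ((\<lambda>(z, \<rho>). cond_risk_dr d \<mu> t z \<rho>) ` S)"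
proof (rule bdd_belowI2 [of _ "- ((\<bar>t\<bar> + \<bar>1 - t\<bar>) * (1 + \<mu>))"], clarify)
  fix z \<rho>
  have "\<bar>a * double_ramp_loss d \<mu> v \<rho>\<bar> \<le> \<bar>a\<bar> * (1 + \<mu>)" for a v
    using d \<mu> double_ramp_loss_bounds [of \<mu> d v \<rho>] by (simp add: abs_mult mult_left_mono)
  from this [of t z] this [of "1 - t" "- z"]
  show "- ((\<bar>t\<bar> + \<bar>1 - t\<bar>) * (1 + \<mu>)) \<le> cond_risk_dr d \<mu> t z \<rho>"
    unfolding cond_risk_dr_def distrib_right by linarith
qed

lemma H_le: "1 / 2 * \<mu> * (1 + \<mu>) \<le> \<rho> \<Longrightarrow> H d \<mu> t \<le> cond_risk_dr d \<mu> t z \<rho>"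
  unfolding H_cond_risk_dr
  using cINF_lower [OF bdd_below_cond_risk_dr,
      of "(z, \<rho>)" "UNIV \<times> {1 / 2 * \<mu> * (1 + \<mu>)..}" t] by simp

lemma H_eq:
  assumes t: "0 \<le> t" "t \<le> 1"
  shows "H d \<mu> t = (1 + \<mu>) * \<xi> d t"
proof (rule antisym)
  have sq: "\<mu>\<^sup>2 \<le> \<mu>" using \<mu> by (simp add: power2_eq_square)
  \<comment> \<open>\<open>\<mu>\<close> is an admissible threshold, and all three witnesses for the
    upper bound use it.\<close>
  then have \<rho>: "1 / 2 * \<mu> * (1 + \<mu>) \<le> \<mu>" by (simp add: power2_eq_square algebra_simps)
  have "double_ramp_loss d \<mu> 0 \<mu> = d * (1 + \<mu>)"
    using \<mu> sq by (simp add: double_ramp_loss_ramp ramp_low ramp_high)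
  then have "cond_risk_dr d \<mu> t 0 \<mu> = (1 + \<mu>) * d"
    by (simp add: cond_risk_dr_def algebra_simps)
  \<comment> \<open>At distance \<open>3 * \<mu>\<close> from 0 both ramps are constant, so
    \<open>z = 0\<close> and these two points realize the three costs of \<open>\<xi>\<close>, each
    scaled by \<open>1 + \<mu>\<close>.\<close>
  moreover have far: "double_ramp_loss d \<mu> (3 * \<mu>) \<mu> = 0"
    "double_ramp_loss d \<mu> (- (3 * \<mu>)) \<mu> = 1 + \<mu>"
    using \<mu> sq by (simp_all add: double_ramp_loss_ramp ramp_low ramp_high algebra_simps)
  then have "cond_risk_dr d \<mu> t (3 * \<mu>) \<mu> = (1 + \<mu>) * (1 - t)"
    "cond_risk_dr d \<mu> t (- (3 * \<mu>)) \<mu> = (1 + \<mu>) * t"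
    unfolding cond_risk_dr_def by simp_all
  ultimately have "H d \<mu> t \<le> (1 + \<mu>) * d" "H d \<mu> t \<le> (1 + \<mu>) * (1 - t)" "H d \<mu> t \<le> (1 + \<mu>) * t"
    using H_le [OF \<rho>] by metis+
  then show "H d \<mu> t \<le> (1 + \<mu>) * \<xi> d t"
    using d by (auto simp: \<xi>_eq_min min_def)
  \<comment> \<open>One copy of \<open>\<xi>\<close> comes from the reject-option risk, the other
    \<open>\<mu>\<close> copies from the excess.\<close>
  have "(1 + \<mu>) * \<xi> d t \<le> cond_risk_dr d \<mu> t z \<rho>'"
    if "1 / 2 * \<mu> * (1 + \<mu>) \<le> \<rho>'" for z \<rho>'
    using cond_risk_excess [OF t that, of z] \<xi>_le_cond_risk_d [OF d t, of z \<rho>']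
    by (simp add: distrib_right)
  then show "(1 + \<mu>) * \<xi> d t \<le> H d \<mu> t"
    unfolding H_cond_risk_dr by (intro cINF_greatest) auto
qed

text \<open>As an infimum of functions affine in \<open>t\<close>, \<open>H\<close> is upper semicontinuous. Measurability is needed
  on all of \<open>\<real>\<close>, because a version of \<open>\<eta>\<close> may leave \<open>[0, 1]\<close> on a null set.\<close>

lemma borel_measurable_H: "H d \<mu> \<in> borel_measurable borel"
proof (rule borel_measurable_iff_less [THEN iffD2], rule allI)
  fix a
  let ?S = "UNIV \<times> {1 / 2 * \<mu> * (1 + \<mu>)..}"
  have ne: "?S \<noteq> {}" by auto
  have "{t. H d \<mu> t < a} = (\<Union>(z, \<rho>) \<in> ?S. {t. cond_risk_dr d \<mu> t z \<rho> < a})"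
    unfolding H_cond_risk_dr cINF_less_iff [OF ne bdd_below_cond_risk_dr] by auto
  also have "open \<dots>"
    unfolding cond_risk_dr_def case_prod_beta
    by (intro open_UN ballI open_Collect_less continuous_intros)
  finally show "{t \<in> space borel. H d \<mu> t < a} \<in> sets borel" by simp
qed

end

section \<open>Conditioning on the feature\<close>

locale labelled_distribution =
  fixes X :: "'a measure" and D :: "('a \<times> real) measure" and \<eta> :: "'a \<Rightarrow> real"
  assumes joint: "joint_distribution X D" and cond: "conditional_label_prob X D \<eta>"
begin

lemma sets_D [measurable_cong]: "sets D = sets (X \<Otimes>\<^sub>M count_space {-1, 1})"
  using joint by (simp add: joint_distribution_def)

lemma space_D: "space D = space X \<times> {-1, 1}"
  using sets_eq_imp_space_eq [OF sets_D] by (simp add: space_pair_measure)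

lemma measurable_fst_D [measurable]: "fst \<in> D \<rightarrow>\<^sub>M X"
  by measurable

lemma borel_measurable_positive_label [measurable]:
  "(\<lambda>p. of_bool (snd p = 1) :: real) \<in> borel_measurable D"
proof -
  have "snd \<in> D \<rightarrow>\<^sub>M count_space {-1, 1}" by measurable
  then show ?thesis
    by (rule measurable_compose) simp
qed

lemma borel_measurable_\<eta> [measurable]: "\<eta> \<in> borel_measurable X"
  using cond by (simp add: conditional_label_prob_def)

sublocale prob_space D
  using joint by (simp add: joint_distribution_def)

lemma measurable_fst_feature_algebra: "fst \<in> feature_algebra X D \<rightarrow>\<^sub>M X"
  unfolding feature_algebra_def by (rule measurable_vimage_algebra1) (auto simp: space_D)

sublocale finite_measure_subalgebra D "feature_algebra X D"
proof
  have "fst \<in> space D \<rightarrow> space X" by (auto simp: space_D)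
  then show "subalgebra D (feature_algebra X D)"
    using measurable_sets [OF measurable_fst_D]
    by (auto simp: subalgebra_def feature_algebra_def sets_vimage_algebra2)
qed

text \<open>Conditional expectation preserves the bounds 0 and 1 of the label indicator, but only
  almost everywhere.\<close>

lemma AE_\<eta>: "AE p in D. 0 \<le> \<eta> (fst p) \<and> \<eta> (fst p) \<le> 1"
proof -
  have int: "integrable D (\<lambda>p. of_bool (snd p = 1) :: real)"
    by (rule integrable_const_bound [of _ 1]) auto
  have "AE p in D. 0 \<le> label_prob X D p"
    unfolding label_prob_def using int by (rule real_cond_exp_ge_c) simp
  moreover have "AE p in D. label_prob X D p \<le> 1"
    unfolding label_prob_def using int by (rule real_cond_exp_le_c) simp
  moreover have "AE p in D. \<eta> (fst p) = label_prob X D p"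
    using cond by (simp add: conditional_label_prob_def)
  ultimately show ?thesis by eventually_elim simp
qed

text \<open>The integrand is \<open>b\<close> plus \<open>a - b\<close> times the label indicator.
  The factor \<open>a - b\<close> depends on the feature alone, so the indicator may be replaced by
  its conditional expectation \<open>\<eta>\<close>.\<close>

lemma integral_condition_on_feature:
  fixes a b :: "'a \<Rightarrow> real"
  assumes [measurable]: "a \<in> borel_measurable X" "b \<in> borel_measurable X"
    and bnd: "\<And>x. \<bar>a x\<bar> \<le> B" "\<And>x. \<bar>b x\<bar> \<le> B"
  shows "integrable D (\<lambda>(x, y). if y = 1 then a x else b x)"
    and "integrable D (\<lambda>(x, y). \<eta> x * a x + (1 - \<eta> x) * b x)"
    and "(\<integral>(x, y). (if y = 1 then a x else b x) \<partial>D) = (\<integral>(x, y). \<eta> x * a x + (1 - \<eta> x) * b x \<partial>D)"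
proof -
  let ?c = "\<lambda>p. a (fst p) - b (fst p)"
  let ?l = "\<lambda>p. of_bool (snd p = 1) :: real"
  have cF: "?c \<in> borel_measurable (feature_algebra X D)"
    by (intro borel_measurable_diff measurable_compose [OF measurable_fst_feature_algebra]) fact+
  have \<eta>: "AE p in D. ?c p * label_prob X D p = ?c p * \<eta> (fst p)"
    using cond by (auto simp: conditional_label_prob_def elim: eventually_mono)
  have bI: "integrable D (\<lambda>p. b (fst p))"
    by (rule integrable_const_bound [of _ B]) (use bnd in auto)
  have aI: "integrable D (\<lambda>p. a (fst p))"
    by (rule integrable_const_bound [of _ B]) (use bnd in auto)
  have lI: "integrable D (\<lambda>p. ?c p * ?l p)"
    by (rule Bochner_Integration.integrable_bound [OF Bochner_Integration.integrable_diff [OF aI bI]]) auto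
  note cond_exp = real_cond_exp_intg [OF lI cF borel_measurable_positive_label, folded label_prob_def]
  have lab [measurable]: "label_prob X D \<in> borel_measurable D"
    unfolding label_prob_def by simp
  \<comment> \<open>\<open>\<eta>\<close> may be unbounded on a null set, so integrability is
    carried over from \<open>label_prob\<close> instead of from a pointwise bound.\<close>
  have \<eta>I: "integrable D (\<lambda>p. ?c p * \<eta> (fst p))"
    using cond_exp(1) by (rule integrable_cong_AE_imp) (use \<eta> in auto)
  have eq: "(\<integral>p. ?c p * ?l p \<partial>D) = (\<integral>p. ?c p * \<eta> (fst p) \<partial>D)"
    unfolding cond_exp(2) [symmetric] by (rule integral_cong_AE) (use \<eta> in auto)
  have split: "(\<lambda>(x, y). if y = 1 then a x else b x) = (\<lambda>p. ?c p * ?l p + b (fst p))"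
    "(\<lambda>(x, y). \<eta> x * a x + (1 - \<eta> x) * b x) = (\<lambda>p. ?c p * \<eta> (fst p) + b (fst p))"
    by (auto simp: fun_eq_iff algebra_simps)
  show "integrable D (\<lambda>(x, y). if y = 1 then a x else b x)"
    "integrable D (\<lambda>(x, y). \<eta> x * a x + (1 - \<eta> x) * b x)"
    "(\<integral>(x, y). (if y = 1 then a x else b x) \<partial>D) = (\<integral>(x, y). \<eta> x * a x + (1 - \<eta> x) * b x \<partial>D)"
    unfolding split using lI \<eta>I bI eq by simp_all
qed

section \<open>From conditional risks to risks\<close>

context
  fixes d \<mu> :: real and f :: "'a \<Rightarrow> real"
  assumes d: "0 < d" "d < 1 / 2" and \<mu>: "0 < \<mu>" "\<mu> \<le> 1"
    and f [measurable]: "f \<in> borel_measurable X"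
begin

lemma risk_d_cond_risk:
  shows "integrable D (\<lambda>(x, y). cond_risk_d d (\<eta> x) (f x) \<rho>)"
    and "risk_d D d f \<rho> = (\<integral>(x, y). cond_risk_d d (\<eta> x) (f x) \<rho> \<partial>D)"
proof -
  have bnd: "\<bar>reject_loss d y v \<rho>\<bar> \<le> 2" for y v
    using d by (simp add: reject_loss_def of_bool_def)
  note * = integral_condition_on_feature
    [of "\<lambda>x. reject_loss d 1 (f x) \<rho>" "\<lambda>x. reject_loss d (- 1) (f x) \<rho>", OF _ _ bnd bnd]
  show "integrable D (\<lambda>(x, y). cond_risk_d d (\<eta> x) (f x) \<rho>)"
    unfolding cond_risk_d_def by (rule *(2)) measurable
  \<comment> \<open>On \<open>space D\<close> every label other than 1 is -1, so the two branches
    cover the integrand.\<close>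
  have "risk_d D d f \<rho> =
      (\<integral>(x, y). (if y = 1 then reject_loss d 1 (f x) \<rho> else reject_loss d (- 1) (f x) \<rho>) \<partial>D)"
    unfolding risk_d_def by (rule Bochner_Integration.integral_cong) (auto simp: space_D)
  also have "\<dots> = (\<integral>(x, y). cond_risk_d d (\<eta> x) (f x) \<rho> \<partial>D)"
    unfolding cond_risk_d_def by (rule *(3)) measurable
  finally show "risk_d D d f \<rho> = (\<integral>(x, y). cond_risk_d d (\<eta> x) (f x) \<rho> \<partial>D)" .
qed

lemma risk_dr_cond_risk:
  shows "integrable D (\<lambda>(x, y). cond_risk_dr d \<mu> (\<eta> x) (f x) \<rho>)"
    and "risk_dr D d \<mu> f \<rho> = (\<integral>(x, y). cond_risk_dr d \<mu> (\<eta> x) (f x) \<rho> \<partial>D)"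
proof -
  have bnd: "\<bar>double_ramp_loss d \<mu> v \<rho>\<bar> \<le> 1 + \<mu>" for v
    using d \<mu> double_ramp_loss_bounds [of \<mu> d v \<rho>] by simp
  note * = integral_condition_on_feature
    [of "\<lambda>x. double_ramp_loss d \<mu> (f x) \<rho>" "\<lambda>x. double_ramp_loss d \<mu> (- f x) \<rho>", OF _ _ bnd bnd]
  show "integrable D (\<lambda>(x, y). cond_risk_dr d \<mu> (\<eta> x) (f x) \<rho>)"
    unfolding cond_risk_dr_def by (rule *(2)) measurable
  have "risk_dr D d \<mu> f \<rho> =
      (\<integral>(x, y). (if y = 1 then double_ramp_loss d \<mu> (f x) \<rho> else double_ramp_loss d \<mu> (- f x) \<rho>) \<partial>D)"
    unfolding risk_dr_def by (rule Bochner_Integration.integral_cong) (auto simp: space_D)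
  also have "\<dots> = (\<integral>(x, y). cond_risk_dr d \<mu> (\<eta> x) (f x) \<rho> \<partial>D)"
    unfolding cond_risk_dr_def by (rule *(3)) measurable
  finally show "risk_dr D d \<mu> f \<rho> = (\<integral>(x, y). cond_risk_dr d \<mu> (\<eta> x) (f x) \<rho> \<partial>D)" .
qed

text \<open>The identity \<open>H_eq\<close> holds on \<open>[0, 1]\<close>, where
  \<open>\<eta>\<close> lies almost everywhere.\<close>

lemma optimal_risk_dr_eq: "optimal_risk_dr D \<eta> d \<mu> = (1 + \<mu>) * optimal_risk_d D \<eta> d"
proof -
  have [measurable]: "H d \<mu> \<in> borel_measurable borel"
    by (rule borel_measurable_H [OF d \<mu>])
  have "optimal_risk_dr D \<eta> d \<mu> = (\<integral>p. (1 + \<mu>) * \<xi> d (\<eta> (fst p)) \<partial>D)"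
    unfolding optimal_risk_dr_def case_prod_beta
  proof (rule integral_cong_AE)
    show "AE p in D. H d \<mu> (\<eta> (fst p)) = (1 + \<mu>) * \<xi> d (\<eta> (fst p))"
      using AE_\<eta> by eventually_elim (simp add: H_eq [OF d \<mu>])
  qed measurable
  then show ?thesis
    unfolding optimal_risk_d_def case_prod_beta by simp
qed

lemma excess_risk:
  assumes \<rho>: "1 / 2 * \<mu> * (1 + \<mu>) \<le> \<rho>"
  shows "risk_d D d f \<rho> + \<mu> * optimal_risk_d D \<eta> d \<le> risk_dr D d \<mu> f \<rho>"
proof -
  note rd = risk_d_cond_risk [of \<rho>, unfolded case_prod_beta]
  note rdr = risk_dr_cond_risk [of \<rho>, unfolded case_prod_beta]
  \<comment> \<open>The bound is almost sure only, since \<open>\<xi>\<close> is unbounded below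
    outside \<open>[0, 1]\<close>.\<close>
  have \<xi>I: "integrable D (\<lambda>p. \<xi> d (\<eta> (fst p)))"
  proof (rule integrable_const_bound [of _ 1])
    show "AE p in D. norm (\<xi> d (\<eta> (fst p))) \<le> 1"
      using AE_\<eta> by eventually_elim (use d in \<open>auto simp: \<xi>_eq_min min_def\<close>)
  qed measurable
  have "risk_d D d f \<rho> + \<mu> * optimal_risk_d D \<eta> d =
      (\<integral>p. cond_risk_d d (\<eta> (fst p)) (f (fst p)) \<rho> + \<mu> * \<xi> d (\<eta> (fst p)) \<partial>D)"
    unfolding optimal_risk_d_def case_prod_beta using rd \<xi>I by simp
  also have "\<dots> \<le> (\<integral>p. cond_risk_dr d \<mu> (\<eta> (fst p)) (f (fst p)) \<rho> \<partial>D)"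
  proof (rule integral_mono_AE)
    show "AE p in D. cond_risk_d d (\<eta> (fst p)) (f (fst p)) \<rho> + \<mu> * \<xi> d (\<eta> (fst p))
        \<le> cond_risk_dr d \<mu> (\<eta> (fst p)) (f (fst p)) \<rho>"
      using AE_\<eta> by eventually_elim (simp add: cond_risk_excess [OF d \<mu> _ _ \<rho>])
  qed (use rd rdr \<xi>I in auto)
  finally show ?thesis using rdr by simp
qed

end

end

theorem theorem3:
  fixes X :: "'a measure"
    and D :: "('a \<times> real) measure"
    and \<eta> f :: "'a \<Rightarrow> real"
    and d \<mu> \<rho> :: real
  assumes "0 < d" "d < 1 / 2"
    and "0 < \<mu>" "\<mu> \<le> 1"
    and "\<rho> \<ge> 1 / 2 * \<mu> * (1 + \<mu>)"
    and "joint_distribution X D"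
    and "conditional_label_prob X D \<eta>"
    and "f \<in> borel_measurable X"
  shows "risk_d D d f \<rho> - optimal_risk_d D \<eta> d
           \<le> risk_dr D d \<mu> f \<rho> - optimal_risk_dr D \<eta> d \<mu> \<and>
         (\<forall>fs \<rho>s. generalized_bayes X D \<eta> d \<mu> fs \<rho>s \<longrightarrow>
           risk_d D d f \<rho> - risk_d D d fs \<rho>s
             \<le> risk_dr D d \<mu> f \<rho> - risk_dr D d \<mu> fs \<rho>s)"
proof -
  interpret labelled_distribution X D \<eta>
    using assms by unfold_locales
  \<comment> \<open>Subtracting \<open>1 + \<mu>\<close> times the optimal reject-option risk
    cancels the \<open>\<mu>\<close> copies in \<open>excess_risk\<close> and leaves one on the
    left.\<close>
  have "risk_d D d f \<rho> - optimal_risk_d D \<eta> d \<le> risk_dr D d \<mu> f \<rho> - optimal_risk_dr D \<eta> d \<mu>"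
    using excess_risk [of d \<mu> f \<rho>] optimal_risk_dr_eq [of d \<mu>] assms
    by (simp add: distrib_right)
  \<comment> \<open>A generalized Bayes pair attains both optimal risks, so its risks may be put in
    their place.\<close>
  then show ?thesis
    by (simp add: generalized_bayes_def)
qed

end
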